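(* For every positive integer $m$ there exists $n_0$ such that for all integers $n\ge n_0$ the combinatorial bigraph $H_{n,n-m}$ is gapless.
   Context: For positive integers $k<n$, the $(n,k)$-combinatorial bigraph $H_{n,k}$ has left vertices the $k$-element subsets of $[n]$, right vertices $[n]$, and an edge between a subset $S$ and $j\in[n]$ iff $j\in S$. General notions: a bigraph $H$ has left part $[N]$, right part $[M]$, neighborhoods $\mathcal N(\cdot)$; its base graph $G_H$ is the graph on $[N]$ where distinct $u,v$ are adjacent iff they share a neighbor. With Lebesgue measure $\mu$ on $[0,1]^M$, a family $\{A_1,\dots,A_N\}$ of measurable sets conforms with $H$ if each $A_i=B_i\times[0,1]^{[M]\setminus\mathcal N(i)}$ with $B_i\subseteq[0,1]^{\mathcal N(i)}$ measurable; $\mathcal I(H)$ is the set of $\vec p\in(0,1)^N$ such that $\mu(\bigcap_i([0,1]^M\setminus A_i))>0$ for every conforming family with $\mu(A_i)=p_i$. For a graph $G$ on $[N]$, $\mathcal I_a(G)$ is the set of $\vec p\in(0,1)^N$ such that for every probability space and events $A_1,\dots,A_N$ with $\Pr(A_i)=p_i$ for which $G$ is a dependency graph (each $A_i$ mutually independent of $\{A_j:j\ne i,j\notin\mathcal N_G(i)\}$), $\Pr(\bigcap_i\overline{A_i})>0$. $H$ is gapful if there are $\vec p\in(0,1)^N$, $\lambda>0$ with $\lambda\vec p\in\mathcal I(H)\setminus\mathcal I_a(G_H)$, and gapless otherwise. *)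

theory Defs
  imports "HOL-Probability.Probability"
begin

text \<open>
  Bigraphs have arbitrary (finite) vertex sets instead of \<open>[N]\<close> and \<open>[M]\<close>. Vectors indexed by the
  left part are functions, of which only the values on the left part matter.
\<close>

record ('a, 'b) bigraph =
  left :: "'a set"
  right :: "'b set"
  edges :: "('a \<times> 'b) set"

definition nbrs :: "('a, 'b) bigraph \<Rightarrow> 'a \<Rightarrow> 'b set" where
  "nbrs H i = {j \<in> right H. (i, j) \<in> edges H}"

definition combinatorial_bigraph :: "nat \<Rightarrow> nat \<Rightarrow> (nat set, nat) bigraph" where
  "combinatorial_bigraph n k =
    (let L = {S. S \<subseteq> {1..n} \<and> card S = k}
     in \<lparr>left = L, right = {1..n}, edges = {(S, j). S \<in> L \<and> j \<in> {1..n} \<and> j \<in> S}\<rparr>)"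

definition base_adj :: "('a, 'b) bigraph \<Rightarrow> 'a \<Rightarrow> 'a \<Rightarrow> bool" where
  "base_adj H u v \<longleftrightarrow>
     u \<in> left H \<and> v \<in> left H \<and> u \<noteq> v \<and> nbrs H u \<inter> nbrs H v \<noteq> {}"

abbreviation unit_interval :: "real measure" where
  "unit_interval \<equiv> restrict_space lborel {0..1}"

text \<open>
  Lebesgue measure on \<open>[0,1]\<^sup>I\<close>: the completion makes all Lebesgue measurable sets measurable,
  not only the Borel sets.
\<close>

definition lebesgue_cube :: "'b set \<Rightarrow> ('b \<Rightarrow> real) measure" where
  "lebesgue_cube I = completion (Pi\<^sub>M I (\<lambda>_. unit_interval))"

text \<open>The cylinder over \<open>B\<close> is the product of \<open>B\<close> with the cube over the remaining coordinates.\<close>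

definition conforms :: "('a, 'b) bigraph \<Rightarrow> ('a \<Rightarrow> ('b \<Rightarrow> real) set) \<Rightarrow> bool" where
  "conforms H A \<longleftrightarrow>
     (\<forall>i\<in>left H. \<exists>B\<in>sets (lebesgue_cube (nbrs H i)).
        A i = prod_emb (right H) (\<lambda>_. unit_interval) (nbrs H i) B)"

definition interior_bigraph :: "('a, 'b) bigraph \<Rightarrow> ('a \<Rightarrow> real) set" where
  "interior_bigraph H =
     {p \<in> left H \<rightarrow> {0<..<1}. \<forall>A.
        conforms H A \<longrightarrow> (\<forall>i\<in>left H. measure (lebesgue_cube (right H)) (A i) = p i) \<longrightarrow>
        \<P>(x in lebesgue_cube (right H). \<forall>i\<in>left H. x \<notin> A i) > 0}"

text \<open>
  Mutual independence of an event from a family of events is independence from the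
  sigma-algebra generated by the family.
\<close>

definition dependency_graph ::
  "'c measure \<Rightarrow> 'a set \<Rightarrow> ('a \<Rightarrow> 'a \<Rightarrow> bool) \<Rightarrow> ('a \<Rightarrow> 'c set) \<Rightarrow> bool" where
  "dependency_graph M V adj A \<longleftrightarrow>
     (\<forall>i\<in>V. prob_space.indep_set M {A i}
        (sigma_sets (space M) (A ` {j \<in> V. j \<noteq> i \<and> \<not> adj i j})))"

text \<open>
  A definition cannot quantify over the type of the sample space. Sample spaces of type
  \<open>'a set\<close>, where \<open>'a\<close> is the type of vertices, are general enough: for finite vertex sets,
  \<open>interior_graphD\<close> below extends the defining property to probability spaces of any type.
\<close>

definition interior_graph :: "'a set \<Rightarrow> ('a \<Rightarrow> 'a \<Rightarrow> bool) \<Rightarrow> ('a \<Rightarrow> real) set" where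
  "interior_graph V adj =
     {p \<in> V \<rightarrow> {0<..<1}. \<forall>(M :: 'a set measure) A.
        prob_space M \<longrightarrow> (\<forall>i\<in>V. A i \<in> sets M \<and> measure M (A i) = p i) \<longrightarrow>
        dependency_graph M V adj A \<longrightarrow> \<P>(x in M. \<forall>i\<in>V. x \<notin> A i) > 0}"

definition gapful :: "('a, 'b) bigraph \<Rightarrow> bool" where
  "gapful H \<longleftrightarrow>
     (\<exists>p \<in> left H \<rightarrow> {0<..<1}. \<exists>r>0.
        (\<lambda>i. r * p i) \<in> interior_bigraph H - interior_graph (left H) (base_adj H))"

abbreviation gapless :: "('a, 'b) bigraph \<Rightarrow> bool" where
  "gapless H \<equiv> \<not> gapful H"

lemma interior_graphD:
  fixes M :: "'c measure" and V :: "'a set"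
  assumes p: "p \<in> interior_graph V adj" and V: "finite V" and M: "prob_space M"
    and A: "\<And>i. i \<in> V \<Longrightarrow> A i \<in> sets M" "\<And>i. i \<in> V \<Longrightarrow> measure M (A i) = p i"
    and dep: "dependency_graph M V adj A"
  shows "\<P>(x in M. \<forall>i\<in>V. x \<notin> A i) > 0"
proof -
  interpret prob_space M by fact
  define f where "f x = {i \<in> V. x \<in> A i}" for x
  define N where "N = distr M (count_space (Pow V)) f"
  define A' where "A' i = {S \<in> Pow V. i \<in> S}" for i
  have fsp: "f \<in> space M \<rightarrow> Pow V" by (auto simp: f_def)
  have f: "f \<in> M \<rightarrow>\<^sub>M count_space (Pow V)"
  proof -
    have "f -` {S} \<inter> space M \<in> sets M" if "S \<in> Pow V" for S
    proof -
      have "f -` {S} \<inter> space M = {x \<in> space M. \<forall>i\<in>V. x \<in> A i \<longleftrightarrow> i \<in> S}"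
      proof -
        have "f x = S \<longleftrightarrow> (\<forall>i\<in>V. x \<in> A i \<longleftrightarrow> i \<in> S)" for x
          using that unfolding f_def by blast
        then show ?thesis by blast
      qed
      also have "\<dots> \<in> sets M"
      proof (rule sets.sets_Collect_finite_All[where S = V and P = "\<lambda>i x. x \<in> A i \<longleftrightarrow> i \<in> S"])
        fix i assume "i \<in> V"
        then have "A i \<in> sets M" by (rule A(1))
        moreover have "{x \<in> space M. x \<in> A i \<longleftrightarrow> i \<in> S} =
            (if i \<in> S then space M \<inter> A i else space M - A i)"
          by auto
        ultimately show "{x \<in> space M. x \<in> A i \<longleftrightarrow> i \<in> S} \<in> sets M"
          by simp
      qed (rule V)
      finally show ?thesis .
    qed
    with fsp V show ?thesis by (simp add: measurable_count_space_eq2)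
  qed
  have N: "prob_space N" unfolding N_def by (rule prob_space_distr) (rule f)
  interpret N: prob_space N by fact
  have sp: "space N = Pow V" and se: "sets N = Pow (Pow V)" by (simp_all add: N_def)
  have mN: "measure N X = measure M (f -` X \<inter> space M)" if "X \<subseteq> Pow V" for X
    unfolding N_def using that by (intro measure_distr f) auto
  have fA: "f -` A' i \<inter> space M = A i" if "i \<in> V" for i
    using that sets.sets_into_space[OF A(1)[OF that]] by (auto simp: f_def A'_def)
  have "dependency_graph N V adj A'"
    unfolding dependency_graph_def
  proof
    fix i assume i: "i \<in> V"
    define J where "J = {j \<in> V. j \<noteq> i \<and> \<not> adj i j}"
    have ind: "indep_set {A i} (sigma_sets (space M) (A ` J))"
      using dep i unfolding dependency_graph_def J_def by blast
    have sub: "sigma_sets (Pow V) (A' ` J) \<subseteq> Pow (Pow V)"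
      using sigma_sets_into_sp[of "A' ` J" "Pow V"] by (auto simp: A'_def)
    have "measure N (A' i \<inter> b) = measure N (A' i) * measure N b"
      if b: "b \<in> sigma_sets (Pow V) (A' ` J)" for b
    proof -
      have "f -` b \<inter> space M \<in> {f -` X \<inter> space M |X. X \<in> sigma_sets (Pow V) (A' ` J)}"
        using b by blast
      also have "\<dots> = sigma_sets (space M) {f -` X \<inter> space M |X. X \<in> A' ` J}"
        by (rule sigma_sets_vimage_commute[OF fsp])
      also have "{f -` X \<inter> space M |X. X \<in> A' ` J} = A ` J"
      proof -
        have "{f -` X \<inter> space M |X. X \<in> A' ` J} = (\<lambda>i. f -` A' i \<inter> space M) ` J"
          by blast
        also have "\<dots> = A ` J"
          by (rule image_cong[OF refl], rule fA) (simp add: J_def)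
        finally show ?thesis .
      qed
      finally have "prob (A i \<inter> (f -` b \<inter> space M)) = prob (A i) * prob (f -` b \<inter> space M)"
        by (intro indep_setD[OF ind]) simp_all
      moreover have "f -` (A' i \<inter> b) \<inter> space M = A i \<inter> (f -` b \<inter> space M)"
        using fA[OF i] by blast
      moreover have "b \<subseteq> Pow V" using b sub by blast
      ultimately show ?thesis
        using fA[OF i] by (subst (1 2 3) mN) (auto simp: A'_def)
    qed
    then show "N.indep_set {A' i} (sigma_sets (space N) (A' ` {j \<in> V. j \<noteq> i \<and> \<not> adj i j}))"
      unfolding J_def[symmetric] sp
      using sub by (intro N.indep_setI) (auto simp: se A'_def)
  qed
  moreover have "measure N (A' i) = p i" if "i \<in> V" for i
    using that A(2) fA by (subst mN) (auto simp: A'_def)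
  moreover have "A' i \<in> sets N" for i by (auto simp: se A'_def)
  ultimately have "\<P>(x in N. \<forall>i\<in>V. x \<notin> A' i) > 0"
    using p N unfolding interior_graph_def by blast
  moreover have "f -` {x \<in> space N. \<forall>i\<in>V. x \<notin> A' i} \<inter> space M = {x \<in> space M. \<forall>i\<in>V. x \<notin> A i}"
    by (auto simp: sp f_def A'_def)
  ultimately show ?thesis
    by (subst (asm) mN) (auto simp: sp)
qed

end

theory Submission imports Defs begin

text \<open>
  By the union bound it suffices to show that no \<open>q\<close> with \<open>\<Sum>S. q S \<ge> 1\<close> lies in the interior of the
  bigraph, and after scaling (and enlarging the sets again at the end) that for \<open>\<Sum>S. q S = 1\<close> the
  cube can be partitioned into cylinders \<open>A S\<close> of measure \<open>q S\<close> with base in the coordinates \<open>S\<close>.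
  Since \<open>\<Sum>j. \<Sum>{q S | S. j \<notin> S} = m\<close>, for large \<open>n\<close> there is a set \<open>R\<close> of \<open>2 m + 1\<close> coordinates such
  that the sets \<open>S\<close> with \<open>\<not> R \<subseteq> S\<close> have small total weight. Any two \<open>(m+1)\<close>-subsets of \<open>R\<close> meet, so the cells
  \<open>C U = {x. \<forall>c\<in>U. x c \<in> J U}\<close> are disjoint if distinct \<open>U\<close> are given disjoint intervals \<open>J U\<close>.
  Every \<open>S\<close> contains some \<open>(m+1)\<close>-subset \<open>U\<close> of \<open>R\<close>; if \<open>\<not> R \<subseteq> S\<close>, a piece of \<open>C U\<close> is cut off for \<open>S\<close>.
  The rest of the cube depends only on the coordinates in \<open>R\<close> and is divided among the \<open>S\<close> with \<open>R \<subseteq> S\<close>.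
\<close>

section \<open>Borel cubes and sigma-algebras of cylinders\<close>

definition cube :: "'b set \<Rightarrow> ('b \<Rightarrow> real) measure" where
  "cube I = Pi\<^sub>M I (\<lambda>_. unit_interval)"

text \<open>Only Borel bases are needed, so the completion in \<open>lebesgue_cube\<close> can be avoided.\<close>

definition cylinders :: "'b set \<Rightarrow> 'b set \<Rightarrow> ('b \<Rightarrow> real) set set" where
  "cylinders I J = sets (vimage_algebra (space (cube I)) (\<lambda>x. restrict x J) (cube J))"

lemma prob_space_unit_interval: "prob_space unit_interval"
  by (rule prob_spaceI) (simp add: emeasure_restrict_space)

interpretation unit: product_prob_space "\<lambda>_. unit_interval" I for I :: "'b set"
proof -
  interpret U: prob_space unit_interval by (rule prob_space_unit_interval)
  show "product_prob_space (\<lambda>_. unit_interval)" by unfold_locales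
qed

lemma prob_space_cube: "prob_space (cube I)"
  unfolding cube_def by (rule prob_space_PiM) (rule prob_space_unit_interval)

lemma space_cube: "space (cube I) = I \<rightarrow>\<^sub>E {0..1}"
  by (simp add: cube_def space_PiM)

lemma measurable_restrict_cube:
  assumes "J \<subseteq> I" shows "(\<lambda>x. restrict x J) \<in> cube I \<rightarrow>\<^sub>M cube J"
  unfolding cube_def using assms by (rule measurable_restrict_subset)

text \<open>Bridges two views. As a \<open>vimage_algebra\<close>, \<open>cylinders I J\<close>
  inherits closure under set operations from sigma-algebras; the explicit form with
  \<open>prod_emb\<close> is the one that \<open>conforms\<close> asks for.\<close>

lemma cylinders_eq:
  assumes "J \<subseteq> I"
  shows "cylinders I J = {prod_emb I (\<lambda>_. unit_interval) J B | B. B \<in> sets (cube J)}"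
proof -
  have "(\<lambda>x. restrict x J) \<in> space (cube I) \<rightarrow> space (cube J)"
    using assms by (auto simp: space_cube)
  then have "cylinders I J = {(\<lambda>x. restrict x J) -` B \<inter> space (cube I) | B. B \<in> sets (cube J)}"
    unfolding cylinders_def by (rule sets_vimage_algebra2)
  then show ?thesis by (simp add: prod_emb_def space_cube)
qed

lemma cylinders_subset_sets: "J \<subseteq> I \<Longrightarrow> cylinders I J \<subseteq> sets (cube I)"
  unfolding cylinders_eq prod_emb_def
  using measurable_sets[OF measurable_restrict_cube[of J I]] by (auto simp: space_cube)

text \<open>Two successive embeddings compose to one. This lets a piece built over few coordinates
  serve for any vertex whose neighborhood contains them.\<close>

lemma cylinders_mono:
  assumes "J \<subseteq> K" "K \<subseteq> I" shows "cylinders I J \<subseteq> cylinders I K"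
proof
  fix X assume "X \<in> cylinders I J"
  then obtain B where B: "B \<in> sets (cube J)" and X: "X = prod_emb I (\<lambda>_. unit_interval) J B"
    using assms by (auto simp: cylinders_eq)
  have "X = prod_emb I (\<lambda>_. unit_interval) K (prod_emb K (\<lambda>_. unit_interval) J B)"
    unfolding X using assms by (subst prod_emb_trans) auto
  moreover have "prod_emb K (\<lambda>_. unit_interval) J B \<in> sets (cube K)"
    using B assms cylinders_subset_sets[of J K] by (auto simp: cylinders_eq)
  ultimately show "X \<in> cylinders I K" using assms(2) by (auto simp: cylinders_eq)
qed

lemma cylinders_Diff: "X \<in> cylinders I J \<Longrightarrow> Y \<in> cylinders I J \<Longrightarrow> X - Y \<in> cylinders I J"
  and cylinders_Int: "X \<in> cylinders I J \<Longrightarrow> Y \<in> cylinders I J \<Longrightarrow> X \<inter> Y \<in> cylinders I J"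
  and cylinders_Un: "X \<in> cylinders I J \<Longrightarrow> Y \<in> cylinders I J \<Longrightarrow> X \<union> Y \<in> cylinders I J"
  unfolding cylinders_def by auto

lemma cylinders_UN:
  "finite S \<Longrightarrow> (\<And>s. s \<in> S \<Longrightarrow> F s \<in> cylinders I J) \<Longrightarrow> (\<Union>s\<in>S. F s) \<in> cylinders I J"
  unfolding cylinders_def by (rule sets.finite_UN)

lemma space_in_cylinders: "space (cube I) \<in> cylinders I J"
  unfolding cylinders_def by (metis sets.top space_vimage_algebra)

lemma slab_in_cylinders:
  assumes "c \<in> J" "J \<subseteq> I" "Z \<in> sets borel"
  shows "{x \<in> space (cube I). x c \<in> Z} \<in> cylinders I J"
proof -
  let ?B = "{x \<in> space (cube J). x c \<in> Z}"
  have "(\<lambda>x. x c) \<in> cube J \<rightarrow>\<^sub>M unit_interval"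
    unfolding cube_def by (rule measurable_component_singleton) (rule assms)
  moreover have "(\<lambda>t. t) \<in> unit_interval \<rightarrow>\<^sub>M borel"
    by (rule measurable_restrict_space1) simp
  ultimately have "(\<lambda>x. x c) \<in> borel_measurable (cube J)"
    by (rule measurable_compose)
  then have "?B \<in> sets (cube J)" using assms(3) by measurable
  moreover have "{x \<in> space (cube I). x c \<in> Z} = prod_emb I (\<lambda>_. unit_interval) J ?B"
    using assms by (auto simp: prod_emb_def space_cube)
  ultimately show ?thesis using assms by (auto simp: cylinders_eq)
qed

lemma measure_box:
  assumes "finite U" "U \<subseteq> I" "0 \<le> a" "a \<le> b" "b \<le> 1"
  shows "measure (cube I) {x \<in> space (cube I). \<forall>c\<in>U. x c \<in> {a..<b}} = (b - a) ^ card U"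
proof -
  have Z: "{a..<b} \<in> sets unit_interval"
    using assms by (auto simp: sets_restrict_space_iff)
  have "{x \<in> space (cube I). \<forall>c\<in>U. x c \<in> {a..<b}} =
      prod_emb I (\<lambda>_. unit_interval) U (\<Pi>\<^sub>E c\<in>U. {a..<b})"
    by (auto simp: prod_emb_def space_cube PiE_iff extensional_def)
  also have "measure (cube I) \<dots> = (\<Prod>c\<in>U. measure unit_interval {a..<b})"
    unfolding cube_def using assms Z by (intro unit.measure_PiM_emb) auto
  also have "measure unit_interval {a..<b} = b - a"
    using assms by (subst measure_restrict_space) auto
  finally show ?thesis by simp
qed

section \<open>Cutting cylinders into pieces of prescribed measure\<close>

text \<open>Sweep a hyperplane orthogonal to one coordinate \<open>c\<close> of \<open>J\<close>
  across the cube. The measure of the part of \<open>X\<close> behind it varies continuously from 0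
  to that of \<open>X\<close>, so the intermediate value theorem gives the cut. The piece stays a
  cylinder over \<open>J\<close> because \<open>c\<close> lies in \<open>J\<close>.\<close>

lemma slice_exists:
  assumes X: "X \<in> cylinders I J" and J: "J \<subseteq> I" "J \<noteq> {}" and q: "0 \<le> q" "q \<le> measure (cube I) X"
  obtains Y where "Y \<in> cylinders I J" "Y \<subseteq> X" "measure (cube I) Y = q"
proof -
  interpret prob_space "cube I" by (rule prob_space_cube)
  from J obtain c where c: "c \<in> J" by auto
  define E where "E a b = {x \<in> space (cube I). x c \<in> {a..<b}}" for a b
  have E: "E a b \<in> cylinders I J" for a b
    unfolding E_def using c J by (intro slab_in_cylinders) auto
  have ev: "Y \<in> events" if "Y \<in> cylinders I J" for Y
    using cylinders_subset_sets[OF J(1)] that by auto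
  have mE: "prob (E a b) = b - a" if "0 \<le> a" "a \<le> b" "b \<le> 1" for a b
    using measure_box[of "{c}" I a b] c J that by (auto simp: E_def)
  define f where "f t = prob (X \<inter> E 0 t)" for t
  \<comment> \<open>\<open>f\<close> is monotone, and it grows by at most the measure of a slab of
    width \<open>t - s\<close>.\<close>
  have step: "\<bar>f t - f s\<bar> \<le> \<bar>t - s\<bar>" if "0 \<le> s" "s \<le> t" "t \<le> 1" for s t
  proof -
    have "X \<inter> E 0 t = (X \<inter> E 0 s) \<union> (X \<inter> E s t)" using that by (auto simp: E_def)
    then have "f t \<le> f s + prob (X \<inter> E s t)"
      unfolding f_def using ev X E by (metis cylinders_Int measure_Un_le)
    also have "prob (X \<inter> E s t) \<le> prob (E s t)"
      by (rule finite_measure_mono) (auto intro: ev E)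
    finally have "f t \<le> f s + (t - s)" using mE that by simp
    moreover have "f s \<le> f t"
      unfolding f_def
    proof (rule finite_measure_mono)
      show "X \<inter> E 0 s \<subseteq> X \<inter> E 0 t" using that by (auto simp: E_def)
    qed (intro ev cylinders_Int X E)
    ultimately show ?thesis using that by auto
  qed
  have lip: "\<bar>f t - f s\<bar> \<le> \<bar>t - s\<bar>" if "s \<in> {0..1}" "t \<in> {0..1}" for s t
    using step[of s t] step[of t s] that by (cases "s \<le> t") (auto simp: abs_minus_commute)
  have "continuous_on {0..1} f"
    unfolding continuous_on_iff dist_real_def
    using lip by (metis order_le_less_trans)
  moreover have "f 0 = 0" by (simp add: f_def E_def)
  \<comment> \<open>The half-open slab \<open>E 0 1\<close> omits the face where coordinate
    \<open>c\<close> equals 1; that face is null.\<close>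
  moreover have "f 1 \<ge> prob X"
  proof -
    have "prob X \<le> prob ((X \<inter> E 0 1) \<union> (space (cube I) - E 0 1))"
      using sets.sets_into_space[OF ev[OF X]]
      by (intro finite_measure_mono) (auto intro!: ev cylinders_Un cylinders_Int cylinders_Diff X E space_in_cylinders)
    also have "\<dots> \<le> prob (X \<inter> E 0 1) + prob (space (cube I) - E 0 1)"
      by (intro measure_Un_le) (auto intro!: ev cylinders_Int cylinders_Diff X E space_in_cylinders)
    also have "prob (space (cube I) - E 0 1) = 0"
      using mE[of 0 1] by (subst prob_compl) (auto intro: ev E)
    finally show ?thesis by (simp add: f_def)
  qed
  ultimately obtain t where "f t = q"
    using IVT'[of f 0 q 1] q by fastforce
  then show ?thesis
    using that[of "X \<inter> E 0 t"] X E by (auto simp: f_def cylinders_Int)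
qed

text \<open>Induction on \<open>T\<close>: cut off a slice \<open>Y\<close> for one index and treat
  the remaining indices in \<open>X - Y\<close>, which is again a cylinder over \<open>J\<close> and
  has enough measure left.\<close>

lemma slicing:
  assumes "finite T" "J \<subseteq> I" "J \<noteq> {}" "X \<in> cylinders I J"
    and "\<And>t. t \<in> T \<Longrightarrow> 0 \<le> q t" "sum q T \<le> measure (cube I) X"
  shows "\<exists>A. (\<forall>t\<in>T. A t \<in> cylinders I J \<and> A t \<subseteq> X \<and> measure (cube I) (A t) = q t)
    \<and> disjoint_family_on A T"
  using assms
proof (induction T arbitrary: X rule: finite_induct)
  case empty
  then show ?case by (auto simp: disjoint_family_on_def)
next
  case (insert s T)
  interpret prob_space "cube I" by (rule prob_space_cube)
  have ge: "0 \<le> q s" "0 \<le> sum q T" using insert.prems by (auto intro: sum_nonneg)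
  have le: "q s + sum q T \<le> prob X" using insert.hyps insert.prems by simp
  obtain Y where Y: "Y \<in> cylinders I J" "Y \<subseteq> X" "prob Y = q s"
    by (rule slice_exists[of X I J "q s"]) (use insert.prems ge le in auto)
  have "prob (X - Y) = prob X - prob Y"
    using Y insert.prems cylinders_subset_sets[of J I] by (intro finite_measure_Diff) auto
  then obtain A where A: "\<forall>t\<in>T. A t \<in> cylinders I J \<and> A t \<subseteq> X - Y \<and> prob (A t) = q t"
      "disjoint_family_on A T"
    using insert.IH[of "X - Y"] insert.prems le Y by (auto intro: cylinders_Diff)
  have "\<forall>t\<in>insert s T. (A(s := Y)) t \<in> cylinders I J \<and> (A(s := Y)) t \<subseteq> X
      \<and> prob ((A(s := Y)) t) = q t"
    using A(1) Y by auto
  moreover have "disjoint_family_on (A(s := Y)) (insert s T)"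
    unfolding disjoint_family_on_def
  proof (intro ballI impI)
    fix t u assume "t \<in> insert s T" "u \<in> insert s T" "t \<noteq> u"
    then consider "t = s" "u \<in> T" "u \<noteq> s" | "u = s" "t \<in> T" "t \<noteq> s"
      | "t \<in> T" "u \<in> T" "t \<noteq> u" "t \<noteq> s" "u \<noteq> s" by blast
    then show "(A(s := Y)) t \<inter> (A(s := Y)) u = {}"
    proof cases
      case 3
      then show ?thesis using A(2) by (simp add: disjoint_family_on_def)
    qed (use A(1) in auto)
  qed
  ultimately show ?case by blast
qed

section \<open>Averaging over the coordinates\<close>

text \<open>Markov's inequality: at most \<open>m / \<delta>\<close> elements have weight above
  \<delta>, so at least \<open>r\<close> others remain.\<close>

lemma light_subset_exists:
  fixes w :: "'b \<Rightarrow> real"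
  assumes "finite I" "\<And>j. j \<in> I \<Longrightarrow> 0 \<le> w j" "sum w I \<le> m" "\<delta> > 0" "m / \<delta> + real r \<le> card I"
  obtains R where "R \<subseteq> I" "card R = r" "\<And>j. j \<in> R \<Longrightarrow> w j \<le> \<delta>"
proof -
  define H where "H = {j \<in> I. w j > \<delta>}"
  have H: "H \<subseteq> I" by (auto simp: H_def)
  have "card H * \<delta> \<le> sum w H" by (rule sum_bounded_below) (auto simp: H_def)
  also have "\<dots> \<le> sum w I" using assms H by (intro sum_mono2) auto
  finally have "card H \<le> m / \<delta>" using assms by (simp add: field_simps)
  with assms have "real (card H) + r \<le> card I" by linarith
  then have "r \<le> card (I - H)" using H assms(1) by (simp add: card_Diff_subset finite_subset)
  then obtain R where "R \<subseteq> I - H" "card R = r" by (rule obtain_subset_with_card_n)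
  then show ?thesis by (intro that[of R]) (auto simp: H_def not_less subset_iff)
qed

text \<open>Double counting of pairs of a set \<open>S\<close> and an element of \<open>J\<close>
  that it misses. It serves twice below: for \<open>J = I\<close> the factor is the constant
  \<open>m\<close>, and for \<open>J = R\<close> it is at least 1 on every set that does not contain
  \<open>R\<close>.\<close>

lemma sum_missing_weight:
  fixes q :: "'b set \<Rightarrow> real"
  assumes "finite J" "finite L"
  shows "(\<Sum>j\<in>J. sum q {S \<in> L. j \<notin> S}) = (\<Sum>S\<in>L. real (card (J - S)) * q S)"
proof -
  have "(\<Sum>j\<in>J. sum q {S \<in> L. j \<notin> S}) = (\<Sum>j\<in>J. \<Sum>S\<in>L. if j \<notin> S then q S else 0)"
    using assms(2) by (intro sum.cong[OF refl] sum.inter_filter)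
  also have "\<dots> = (\<Sum>S\<in>L. \<Sum>j\<in>J. if j \<notin> S then q S else 0)"
    by (rule sum.swap)
  also have "\<dots> = (\<Sum>S\<in>L. sum (\<lambda>_. q S) {j \<in> J. j \<notin> S})"
    using assms(1) by (intro sum.cong[OF refl] sum.inter_filter[symmetric])
  also have "\<dots> = (\<Sum>S\<in>L. real (card (J - S)) * q S)"
    by (simp add: set_diff_eq)
  finally show ?thesis .
qed

section \<open>Partition of the cube for total weight 1\<close>

text \<open>\<open>K\<close> counts the cells, one for each (m+1)-subset of \<open>R\<close>, so the
  intervals have length 1/K and each cell has measure \<epsilon>. The hypothesis \<open>big\<close>
  is the demand of \<open>light_subset_exists\<close> for 2m+1 coordinates of weight at most
  \<epsilon>/(2m+1).\<close>

lemma partition_exists: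
  fixes q :: "'b set \<Rightarrow> real" and m :: nat
  defines "K \<equiv> (2 * m + 1) choose (m + 1)"
  defines "\<epsilon> \<equiv> (1 / real K) ^ (m + 1)"
  assumes I: "finite I" and L: "\<And>S. S \<in> L \<Longrightarrow> S \<subseteq> I" "\<And>S. S \<in> L \<Longrightarrow> card (I - S) = m"
    and q: "\<And>S. S \<in> L \<Longrightarrow> 0 \<le> q S" "sum q L = 1"
    and big: "real m / (\<epsilon> / real (2 * m + 1)) + real (2 * m + 1) \<le> card I"
  shows "\<exists>A. (\<forall>S\<in>L. A S \<in> cylinders I S \<and> measure (cube I) (A S) = q S) \<and> disjoint_family_on A L"
proof -
  interpret prob_space "cube I" by (rule prob_space_cube)
  have fL: "finite L" using L(1) I by (meson finite_Pow_iff finite_subset PowI subsetI)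
  have K: "K > 0" unfolding K_def by (simp add: zero_less_binomial_iff)
  then have \<epsilon>: "\<epsilon> > 0" by (simp add: \<epsilon>_def)
  have ev: "Y \<in> events" if "Y \<in> cylinders I J" "J \<subseteq> I" for J Y
    using cylinders_subset_sets that by blast
  define w where "w j = sum q {S \<in> L. j \<notin> S}" for j
  have "sum w I = (\<Sum>S\<in>L. real (card (I - S)) * q S)"
    unfolding w_def using I fL by (rule sum_missing_weight)
  also have "\<dots> = m" using L(2) q(2) by (simp flip: sum_distrib_left)
  finally have "sum w I \<le> m" by simp
  moreover have "0 \<le> w j" for j unfolding w_def using q(1) by (auto intro: sum_nonneg)
  ultimately obtain R where R: "R \<subseteq> I" "card R = 2 * m + 1"
      and light: "\<And>j. j \<in> R \<Longrightarrow> w j \<le> \<epsilon> / real (2 * m + 1)"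
    using light_subset_exists[of I w m "\<epsilon> / real (2 * m + 1)" "2 * m + 1"] I \<epsilon> big by auto
  have fR: "finite R" using R I finite_subset by auto
  define Bad where "Bad = {S \<in> L. \<not> R \<subseteq> S}"
  define Good where "Good = {S \<in> L. R \<subseteq> S}"
  have fin: "finite Bad" "finite Good" using fL by (auto simp: Bad_def Good_def)
  \<comment> \<open>A bad set is counted in \<open>w j\<close> for at least one \<open>j\<close> in
    \<open>R\<close>, and these 2m+1 weights add up to at most \<epsilon>.\<close>
  have "sum q Bad \<le> (\<Sum>S\<in>Bad. real (card (R - S)) * q S)"
  proof (rule sum_mono)
    fix S assume S: "S \<in> Bad"
    then have "1 \<le> card (R - S)" using fR by (simp add: Bad_def Suc_le_eq card_gt_0_iff)
    then show "q S \<le> real (card (R - S)) * q S"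
      using S q(1)[of S] by (simp add: Bad_def mult_le_cancel_right1)
  qed
  also have "\<dots> \<le> (\<Sum>S\<in>L. real (card (R - S)) * q S)"
    using fL q by (intro sum_mono2) (auto simp: Bad_def)
  also have "\<dots> = (\<Sum>j\<in>R. w j)"
    unfolding w_def using fR fL by (rule sum_missing_weight[symmetric])
  also have "\<dots> \<le> real (card R) * (\<epsilon> / real (2 * m + 1))"
    by (rule sum_bounded_above) (rule light)
  also have "\<dots> = \<epsilon>" using R by simp
  finally have bad_le: "sum q Bad \<le> \<epsilon>" .

  define Us where "Us = {U. U \<subseteq> R \<and> card U = m + 1}"
  have fUs: "finite Us" using fR by (simp add: Us_def)
  have "card Us = K" using fR R by (simp add: Us_def K_def n_subsets)
  \<comment> \<open>The numbering \<open>e\<close> assigns to each \<open>U\<close> one of the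
    \<open>K\<close> intervals of a uniform grid on [0,1).\<close>
  then obtain e where e: "bij_betw e Us {0..<K}" using ex_bij_betw_finite_nat[OF fUs] by auto
  define C where "C U = {x \<in> space (cube I). \<forall>c\<in>U. x c \<in> {real (e U) / K..<real (e U + 1) / K}}" for U
  have U: "U \<subseteq> I" "U \<noteq> {}" "finite U" if "U \<in> Us" for U
    using that R fR by (auto simp: Us_def finite_subset)
  have C: "C U \<in> cylinders I U" if "U \<in> Us" for U
  proof -
    \<comment> \<open>De Morgan turns the intersection of slabs into a form covered by
      \<open>cylinders_Diff\<close> and \<open>cylinders_UN\<close>.\<close>
    have "C U = space (cube I) - (\<Union>c\<in>U. {x \<in> space (cube I). x c \<in> - {real (e U) / K..<real (e U + 1) / K}})"
      by (auto simp: C_def)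
    also have "\<dots> \<in> cylinders I U"
      using U[OF that] by (intro cylinders_Diff space_in_cylinders cylinders_UN slab_in_cylinders) auto
    finally show ?thesis .
  qed
  have mC: "prob (C U) = \<epsilon>" if "U \<in> Us" for U
  proof -
    have "e U < K" using e that by (auto simp: bij_betw_def)
    then have "prob (C U) = (real (e U + 1) / K - real (e U) / K) ^ card U"
      unfolding C_def using U[OF that] by (intro measure_box) (auto intro: divide_right_mono)
    also have "real (e U + 1) / K - real (e U) / K = 1 / K" using K by (simp add: field_simps)
    finally show ?thesis using that by (simp add: \<epsilon>_def Us_def)
  qed
  have C_disj: "C U \<inter> C V = {}" if UV: "U \<in> Us" "V \<in> Us" "U \<noteq> V" for U V
  proof -
    have "U \<inter> V \<noteq> {}"
    proof
      assume "U \<inter> V = {}"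
      then have "card (U \<union> V) = 2 * m + 2" using UV card_Un_disjoint[OF U(3)[OF UV(1)] U(3)[OF UV(2)]]
        by (simp add: Us_def)
      moreover have "card (U \<union> V) \<le> card R" using UV fR by (intro card_mono) (auto simp: Us_def)
      ultimately show False using R by simp
    qed
    then obtain c where c: "c \<in> U" "c \<in> V" by auto
    have ne: "e U \<noteq> e V" using e UV by (auto simp: bij_betw_def inj_on_def)
    show ?thesis
    proof (rule ccontr)
      assume "C U \<inter> C V \<noteq> {}"
      then obtain x where "x \<in> C U" "x \<in> C V" by auto
      with c have xc: "real (e U) / K \<le> x c" "x c < real (e U + 1) / K"
        "real (e V) / K \<le> x c" "x c < real (e V + 1) / K" by (auto simp: C_def)
      \<comment> \<open>Half-open grid intervals that share a point have the same index.\<close>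
      have "e U < e V + 1" "e V < e U + 1"
        using order_le_less_trans[OF xc(1) xc(4)] order_le_less_trans[OF xc(3) xc(2)] K
        by (simp_all add: divide_less_cancel)
      with ne show False by simp
    qed
  qed

  \<comment> \<open>\<open>S\<close> misses at most \<open>m\<close> of the 2m+1 elements of
    \<open>R\<close>, so it contains m+1 of them.\<close>
  have "\<exists>U\<in>Us. U \<subseteq> S" if "S \<in> L" for S
  proof -
    have "card (R - S) \<le> m" using card_mono[of "I - S" "R - S"] I R L(2)[OF that] by auto
    moreover have "card R = card (R \<inter> S) + card (R - S)" using fR
      by (metis Int_Diff_Un Int_Diff_disjoint card_Un_disjoint finite_Diff finite_Int)
    ultimately have "m + 1 \<le> card (R \<inter> S)" using R by simp
    then obtain U where "U \<subseteq> R \<inter> S" "card U = m + 1" by (rule obtain_subset_with_card_n)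
    then show ?thesis by (auto simp: Us_def)
  qed
  then obtain g where g: "\<And>S. S \<in> L \<Longrightarrow> g S \<in> Us \<and> g S \<subseteq> S" by metis
  define slices where "slices U A \<longleftrightarrow>
      (\<forall>S\<in>{S\<in>Bad. g S = U}. A S \<in> cylinders I U \<and> A S \<subseteq> C U \<and> prob (A S) = q S)
      \<and> disjoint_family_on A {S\<in>Bad. g S = U}" for U A
  \<comment> \<open>A single cell has room for all bad sets together, so it does not matter how
    \<open>g\<close> distributes them among the cells.\<close>
  have "\<exists>A. slices U A" if "U \<in> Us" for U
    unfolding slices_def
  proof (rule slicing)
    have "sum q {S\<in>Bad. g S = U} \<le> sum q Bad"
      using fin q by (intro sum_mono2) (auto simp: Bad_def)
    then show "sum q {S\<in>Bad. g S = U} \<le> prob (C U)" using bad_le mC[OF that] by simp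
  qed (use that U C fL q in \<open>auto simp: Bad_def\<close>)
  then obtain F where F: "\<And>U. U \<in> Us \<Longrightarrow> slices U (F U)"
    using bchoice[of Us slices] by blast
  define A where "A S = F (g S) S" for S
  have gUs: "g S \<in> Us" if "S \<in> Bad" for S using g that by (auto simp: Bad_def)
  have A: "A S \<in> cylinders I (g S)" "A S \<subseteq> C (g S)" "prob (A S) = q S" if "S \<in> Bad" for S
    using F[OF gUs[OF that]] that by (auto simp: A_def slices_def)
  \<comment> \<open>Pieces of the same cell are disjoint by slicing, pieces of different cells
    because the cells are.\<close>
  have A_disj: "disjoint_family_on A Bad"
    unfolding disjoint_family_on_def
  proof (intro ballI impI)
    fix S T assume ST: "S \<in> Bad" "T \<in> Bad" "S \<noteq> T"
    show "A S \<inter> A T = {}"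
    proof (cases "g S = g T")
      case True
      then show ?thesis using F[OF gUs[OF ST(1)]] ST by (auto simp: A_def slices_def disjoint_family_on_def)
    next
      case False
      then show ?thesis using A(2)[OF ST(1)] A(2)[OF ST(2)] C_disj[OF gUs[OF ST(1)] gUs[OF ST(2)]] by blast
    qed
  qed
  have AR: "A S \<in> cylinders I R" if "S \<in> Bad" for S
    using A(1)[OF that] cylinders_mono[of "g S" R I] gUs[OF that] R by (auto simp: Us_def)
  \<comment> \<open>Every \<open>g S\<close> lies in \<open>R\<close>, so the leftover is a cylinder
    over \<open>R\<close> and can be shared among all good sets. As the total weight is 1, its
    measure is exactly the good weight.\<close>
  define D where "D = space (cube I) - (\<Union>S\<in>Bad. A S)"
  have D: "D \<in> cylinders I R"
    unfolding D_def using fin by (intro cylinders_Diff space_in_cylinders cylinders_UN AR)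
  have "prob D = 1 - prob (\<Union>S\<in>Bad. A S)"
    unfolding D_def using fin R by (intro prob_compl ev[of _ R] cylinders_UN AR)
  also have "prob (\<Union>S\<in>Bad. A S) = (\<Sum>S\<in>Bad. prob (A S))"
    using fin A_disj R ev AR by (intro finite_measure_finite_Union) auto
  also have "\<dots> = sum q Bad" using A by simp
  also have "1 - sum q Bad = sum q Good"
  proof -
    have "L = Bad \<union> Good" "Bad \<inter> Good = {}" by (auto simp: Bad_def Good_def)
    then have "sum q L = sum q Bad + sum q Good" using fin by (simp add: sum.union_disjoint)
    then show ?thesis using q by simp
  qed
  finally have "sum q Good \<le> prob D" by simp
  moreover have "R \<noteq> {}" using R(2) by auto
  ultimately have "\<exists>G. (\<forall>S\<in>Good. G S \<in> cylinders I R \<and> G S \<subseteq> D \<and> prob (G S) = q S)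
      \<and> disjoint_family_on G Good"
    using fin R(1) D q(1) by (intro slicing) (auto simp: Good_def)
  then obtain G where G: "\<forall>S\<in>Good. G S \<in> cylinders I R \<and> G S \<subseteq> D \<and> prob (G S) = q S"
      "disjoint_family_on G Good" by blast
  define Z where "Z S = (if R \<subseteq> S then G S else A S)" for S
  have "Z S \<in> cylinders I S \<and> prob (Z S) = q S" if S: "S \<in> L" for S
  proof (cases "R \<subseteq> S")
    case True
    then show ?thesis using G(1) S L(1) cylinders_mono[of R S I] by (auto simp: Z_def Good_def)
  next
    case False
    then have "S \<in> Bad" using S by (simp add: Bad_def)
    from False have "Z S = A S" by (simp add: Z_def)
    moreover have "A S \<in> cylinders I S"
      using A(1)[OF \<open>S \<in> Bad\<close>] g[OF S] L(1)[OF S] cylinders_mono by blast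
    ultimately show ?thesis using A(3)[OF \<open>S \<in> Bad\<close>] by simp
  qed
  moreover have "disjoint_family_on Z L"
  proof -
    have "Z S \<inter> Z T = {}" if "S \<in> L" "T \<in> L" "S \<noteq> T" for S T
    proof -
      have ST: "S \<in> (if R \<subseteq> S then Good else Bad)" "T \<in> (if R \<subseteq> T then Good else Bad)"
        using that by (auto simp: Good_def Bad_def)
      consider "R \<subseteq> S" "R \<subseteq> T" | "R \<subseteq> S" "\<not> R \<subseteq> T" | "\<not> R \<subseteq> S" "R \<subseteq> T" | "\<not> R \<subseteq> S" "\<not> R \<subseteq> T" by blast
      then show ?thesis
      proof cases
        case 1 then show ?thesis using ST G(2) that by (auto simp: Z_def disjoint_family_on_def)
      next
        case 2
        then have "G S \<subseteq> D" "A T \<inter> D = {}" using ST G(1) by (auto simp: D_def)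
        then show ?thesis using 2 by (auto simp: Z_def)
      next
        case 3
        then have "G T \<subseteq> D" "A S \<inter> D = {}" using ST G(1) by (auto simp: D_def)
        then show ?thesis using 3 by (auto simp: Z_def)
      next
        case 4 then show ?thesis using ST A_disj that by (auto simp: Z_def disjoint_family_on_def)
      qed
    qed
    then show ?thesis by (simp add: disjoint_family_on_def)
  qed
  ultimately show ?thesis by blast
qed

section \<open>Null complement for total weight at least 1\<close>

text \<open>Dividing by the total weight \<open>s\<close>, which is at least 1, reduces to a
  partition with smaller or equal pieces. Enlarging each piece to its intended measure keeps the
  cube covered up to a null set.\<close>

lemma cover_exists:
  fixes q :: "'b set \<Rightarrow> real" and m :: nat
  defines "K \<equiv> (2 * m + 1) choose (m + 1)"
  defines "\<epsilon> \<equiv> (1 / real K) ^ (m + 1)"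
  assumes I: "finite I" and L: "\<And>S. S \<in> L \<Longrightarrow> S \<subseteq> I" "\<And>S. S \<in> L \<Longrightarrow> card (I - S) = m"
    and q: "\<And>S. S \<in> L \<Longrightarrow> 0 \<le> q S" "\<And>S. S \<in> L \<Longrightarrow> q S \<le> 1" "1 \<le> sum q L"
    and big: "real m / (\<epsilon> / real (2 * m + 1)) + real (2 * m + 1) \<le> card I"
  shows "\<exists>A. (\<forall>S\<in>L. A S \<in> cylinders I S \<and> measure (cube I) (A S) = q S)
    \<and> measure (cube I) {x \<in> space (cube I). \<forall>S\<in>L. x \<notin> A S} = 0"
proof -
  interpret prob_space "cube I" by (rule prob_space_cube)
  have fL: "finite L" using L(1) I by (meson finite_Pow_iff finite_subset PowI subsetI)
  have ev: "Y \<in> events" if "Y \<in> cylinders I S" "S \<in> L" for S Y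
    using cylinders_subset_sets that L(1) by blast
  \<comment> \<open>\<open>slice_exists\<close> needs a coordinate to cut along; here
    \<open>big\<close> ensures that no \<open>S\<close> is empty.\<close>
  have "0 \<le> real m / (\<epsilon> / real (2 * m + 1))" by (simp add: \<epsilon>_def)
  with big have "real (2 * m + 1) \<le> card I" by linarith
  then have cI: "card I > m" by simp
  have ne: "S \<noteq> {}" if "S \<in> L" for S using L(2)[OF that] cI by auto
  define s where "s = sum q L"
  have "\<exists>A. (\<forall>S\<in>L. A S \<in> cylinders I S \<and> prob (A S) = q S / s) \<and> disjoint_family_on A L"
    using q s_def by (intro partition_exists[OF I L _ _ big[unfolded \<epsilon>_def K_def]])
      (auto simp flip: sum_divide_distrib)
  then obtain A where A: "\<And>S. S \<in> L \<Longrightarrow> A S \<in> cylinders I S" "\<And>S. S \<in> L \<Longrightarrow> prob (A S) = q S / s"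
    "disjoint_family_on A L" by auto
  have "\<exists>Z. Z \<in> cylinders I S \<and> A S \<subseteq> Z \<and> prob Z = q S" if S: "S \<in> L" for S
  proof -
    have le: "q S / s \<le> q S" using q(1)[OF S] q(3) by (simp add: s_def divide_le_eq mult_le_cancel_left1)
    have X: "space (cube I) - A S \<in> cylinders I S" using A S by (intro cylinders_Diff space_in_cylinders)
    have "prob (space (cube I) - A S) = 1 - q S / s" using A S ev by (simp add: prob_compl)
    \<comment> \<open>The missing measure fits into the complement of \<open>A S\<close> because
      \<open>q S\<close> is at most 1.\<close>
    then obtain Y where Y: "Y \<in> cylinders I S" "Y \<subseteq> space (cube I) - A S" "prob Y = q S - q S / s"
      using slice_exists[OF X L(1)[OF S] ne[OF S], of "q S - q S / s"] le q S by auto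
    have "prob (A S \<union> Y) = prob (A S) + prob Y"
      using Y A S ev by (intro finite_measure_Union) auto
    then show ?thesis using Y A S by (intro exI[of _ "A S \<union> Y"]) (auto intro: cylinders_Un)
  qed
  then obtain Z where Z: "\<And>S. S \<in> L \<Longrightarrow> Z S \<in> cylinders I S \<and> A S \<subseteq> Z S \<and> prob (Z S) = q S" by metis
  have "prob (\<Union>S\<in>L. A S) = (\<Sum>S\<in>L. prob (A S))"
    using fL A ev by (intro finite_measure_finite_Union) auto
  also have "\<dots> = 1" using A q(3) by (simp add: s_def flip: sum_divide_distrib)
  finally have one: "prob (\<Union>S\<in>L. A S) = 1" .
  have UA: "(\<Union>S\<in>L. A S) \<in> events" using fL A ev by auto
  have "prob {x \<in> space (cube I). \<forall>S\<in>L. x \<notin> Z S} \<le> prob (space (cube I) - (\<Union>S\<in>L. A S))"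
    using Z UA by (intro finite_measure_mono) auto
  also have "\<dots> = 0" using one UA by (simp add: prob_compl)
  finally have "prob {x \<in> space (cube I). \<forall>S\<in>L. x \<notin> Z S} = 0"
    by (simp add: measure_le_0_iff)
  with Z show ?thesis by (intro exI[of _ Z]) simp
qed

section \<open>Union bound and gaplessness\<close>

text \<open>Events of total probability below 1 cannot cover the space. Hence a vector witnessing a
  gap has total weight at least 1, which is the hypothesis of \<open>cover_exists\<close>.\<close>

lemma interior_graph_union_bound:
  assumes "finite V" "p \<in> V \<rightarrow> {0<..<1}" "sum p V < 1"
  shows "p \<in> interior_graph V adj"
  unfolding interior_graph_def
proof (intro CollectI conjI allI impI assms(2))
  fix M :: "'a set measure" and A
  assume M: "prob_space M" and A: "\<forall>i\<in>V. A i \<in> sets M \<and> measure M (A i) = p i"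
  interpret prob_space M by fact
  have "prob (\<Union>i\<in>V. A i) \<le> (\<Sum>i\<in>V. prob (A i))"
    using A assms by (intro finite_measure_subadditive_finite) auto
  also have "\<dots> < 1" using A assms by simp
  finally have "prob (space M - (\<Union>i\<in>V. A i)) > 0" using A assms by (subst prob_compl) auto
  moreover have "space M - (\<Union>i\<in>V. A i) = {x \<in> space M. \<forall>i\<in>V. x \<notin> A i}" by auto
  ultimately show "\<P>(x in M. \<forall>i\<in>V. x \<notin> A i) > 0" by simp
qed

theorem theorem16:
  fixes m :: nat
  assumes "m > 0"
  shows "\<exists>n0>m. \<forall>n\<ge>n0. gapless (combinatorial_bigraph n (n - m))"
proof -
  \<comment> \<open>This is the bound \<open>big\<close> with its constants unfolded. The summand
    \<open>m + 1\<close> in the threshold for \<open>n\<close> gives \<open>n > m\<close>, so that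
    \<open>n - m\<close> is a true subtraction and each complement has exactly \<open>m\<close>
    elements.\<close>
  define b where "b = real m / ((1 / real ((2 * m + 1) choose (m + 1))) ^ (m + 1) / real (2 * m + 1)) + real (2 * m + 1)"
  have "gapless (combinatorial_bigraph n (n - m))" if n: "n \<ge> m + 1 + nat \<lceil>b\<rceil>" for n
  proof
    let ?H = "combinatorial_bigraph n (n - m)" and ?I = "{1..n}"
    define L where "L = {S. S \<subseteq> ?I \<and> card S = n - m}"
    have bn: "b \<le> card ?I" using n by simp linarith
    have fL: "finite L" by (simp add: L_def)
    have H: "left ?H = L" "right ?H = ?I" by (simp_all add: combinatorial_bigraph_def L_def Let_def)
    have nb: "nbrs ?H S = S" if "S \<in> L" for S
      using that by (auto simp: nbrs_def combinatorial_bigraph_def L_def Let_def)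
    assume "gapful ?H"
    then obtain q where q: "q \<in> interior_bigraph ?H" "q \<notin> interior_graph (left ?H) (base_adj ?H)"
      unfolding gapful_def by blast
    then have q01: "q \<in> L \<rightarrow> {0<..<1}" by (auto simp: interior_bigraph_def H)
    then have "\<not> sum q L < 1" using interior_graph_union_bound[OF fL] q(2) H by metis
    then have ge: "1 \<le> sum q L" by simp
    have compl: "card (?I - S) = m" if "S \<in> L" for S
      using that n by (subst card_Diff_subset) (auto simp: L_def finite_subset)
    have LI: "S \<subseteq> ?I" if "S \<in> L" for S using that by (auto simp: L_def)
    have "0 \<le> q S" "q S \<le> 1" if "S \<in> L" for S
      using funcset_mem[OF q01 that] by simp_all
    then have "\<exists>A. (\<forall>S\<in>L. A S \<in> cylinders ?I S \<and> measure (cube ?I) (A S) = q S)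
        \<and> measure (cube ?I) {x \<in> space (cube ?I). \<forall>S\<in>L. x \<notin> A S} = 0"
      using ge by (intro cover_exists[OF _ LI compl _ _ _ bn[unfolded b_def]]) auto
    then obtain A where A: "\<And>S. S \<in> L \<Longrightarrow> A S \<in> cylinders ?I S"
        "\<And>S. S \<in> L \<Longrightarrow> measure (cube ?I) (A S) = q S"
        and null: "measure (cube ?I) {x \<in> space (cube ?I). \<forall>S\<in>L. x \<notin> A S} = 0"
      by blast
    have ev: "A S \<in> sets (cube ?I)" if "S \<in> L" for S
      using A(1)[OF that] cylinders_subset_sets LI[OF that] by blast
    \<comment> \<open>The completion contains the Borel sets and agrees with the Borel measure on
      them, so the Borel cover is also a conforming family in the Lebesgue sense.\<close>
    have lc: "lebesgue_cube J = completion (cube J)" for J :: "nat set"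
      by (simp add: lebesgue_cube_def cube_def)
    have "conforms ?H A"
      unfolding conforms_def H
    proof
      fix S assume S: "S \<in> L"
      show "\<exists>B\<in>sets (lebesgue_cube (nbrs ?H S)). A S = prod_emb ?I (\<lambda>_. unit_interval) (nbrs ?H S) B"
        using A(1)[OF S] unfolding cylinders_eq[OF LI[OF S]] nb[OF S] lc by auto
    qed
    moreover have "measure (lebesgue_cube ?I) (A S) = q S" if "S \<in> L" for S
      using that A(2) ev by (simp add: lc)
    ultimately have "\<P>(x in lebesgue_cube ?I. \<forall>S\<in>L. x \<notin> A S) > 0"
      using q(1) unfolding interior_bigraph_def H by blast
    moreover have "{x \<in> space (cube ?I). \<forall>S\<in>L. x \<notin> A S} \<in> sets (cube ?I)"
      using fL ev by (intro sets.sets_Collect_finite_All) (auto simp: Collect_conj_eq)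
    ultimately show False using null by (simp add: lc)
  qed
  then show ?thesis by (intro exI[of _ "m + 1 + nat \<lceil>b\<rceil>"]) auto
qed

end
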